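(* Let $0<s<1$. Let $\omega:S^1\to\mathbb{R}$ be smooth, nonnegative, not identically zero, with $\omega(\theta+\pi)=\omega(\theta)$, $\omega(\frac{\pi}{2})=0$, and $$\omega(\theta)\ge c\,\big|\theta-\tfrac{\pi}{2}\big|^{\kappa},\quad\forall\theta\in[0,\pi]$$ for some constants $c>0$ and $\kappa\ge2$. For $\alpha>0$ let $E_\alpha$ be the energy associated to $W_\alpha(\mathbf{x})=|\mathbf{x}|^{-s}(1+\alpha\omega(\theta))+|\mathbf{x}|^2$ on $\mathbb{R}^2$. Then, for any minimizer $\rho$ of $E_\alpha$ with zero center of mass, $$\sup_{\mathbf{x}\in\operatorname{supp}\rho}|x_1|\le C\alpha^{-1/(\kappa+1)}$$ with $C$ depending on $s$ and $\omega$ (and not on $\alpha$ or $\rho$).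
   Context: $S^1=[-\pi,\pi)$ is the set of angles (mod $2\pi$); $\theta$ is the angle of $\mathbf{x}\in\mathbb{R}^2\setminus\{0\}$, i.e. $\mathbf{x}/|\mathbf{x}|=(\cos\theta,\sin\theta)$; $\mathbf{x}=(x_1,x_2)$. The energy is $E_\alpha[\rho]=\frac12\int_{\mathbb{R}^2}\int_{\mathbb{R}^2}W_\alpha(\mathbf{x}-\mathbf{y})\rho(\mathbf{y})\,\mathrm{d}\mathbf{y}\,\rho(\mathbf{x})\,\mathrm{d}\mathbf{x}$ for probability measures $\rho$ on $\mathbb{R}^2$; minimizers are global minimizers among probability measures. *)

theory Defs
  imports "HOL-Probability.Probability"
begin

text \<open>
  Functions on the circle are represented by periodic functions on the reals,
  so it is immaterial that \<^const>\<open>Arg\<close> takes its values in \<open>(-pi, pi]\<close> and not in \<open>[-pi, pi)\<close>.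
\<close>

definition angle :: "real^2 \<Rightarrow> real" where
  "angle x = Arg (Complex (x $ 1) (x $ 2))"

lemma polar_angle: "x = norm x *\<^sub>R vector [cos (angle x), sin (angle x)]"
proof -
  let ?z = "Complex (x $ 1) (x $ 2)"
  have n: "norm x = cmod ?z"
    by (simp add: norm_vec_def L2_set_def UNIV_2 cmod_def)
  have "rcis (norm x) (angle x) = ?z"
    unfolding angle_def n by (rule rcis_cmod_Arg)
  then have "norm x * cos (angle x) = x $ 1" "norm x * sin (angle x) = x $ 2"
    by (simp_all add: complex_eq_iff)
  then show ?thesis
    by (simp add: vec_eq_iff forall_2)
qed

definition smooth :: "(real \<Rightarrow> real) \<Rightarrow> bool" where
  "smooth f \<longleftrightarrow> (\<forall>k x. ((deriv ^^ k) f) differentiable (at x))"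

text \<open>
  The kernel is infinite at the origin: with \<open>0 powr (-s) = 0\<close> a Dirac mass would have
  energy zero. Away from the origin \<^const>\<open>ennreal\<close> truncates nothing when \<open>\<alpha>\<close> and \<open>\<omega>\<close>
  are nonnegative.
\<close>

definition W :: "real \<Rightarrow> (real \<Rightarrow> real) \<Rightarrow> real \<Rightarrow> real^2 \<Rightarrow> ennreal" where
  "W s \<omega> \<alpha> x =
     (if x = 0 then \<infinity>
      else ennreal (norm x powr (-s) * (1 + \<alpha> * \<omega> (angle x)) + (norm x)\<^sup>2))"

definition energy :: "(real^2 \<Rightarrow> ennreal) \<Rightarrow> (real^2) measure \<Rightarrow> ennreal" where
  "energy K \<rho> = (1 / 2) * (\<integral>\<^sup>+ x. (\<integral>\<^sup>+ y. K (x - y) \<partial>\<rho>) \<partial>\<rho>)"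

definition borel_prob :: "(real^2) measure \<Rightarrow> bool" where
  "borel_prob \<rho> \<longleftrightarrow> prob_space \<rho> \<and> sets \<rho> = sets borel"

definition energy_minimizer :: "(real^2 \<Rightarrow> ennreal) \<Rightarrow> (real^2) measure \<Rightarrow> bool" where
  "energy_minimizer K \<rho> \<longleftrightarrow>
     borel_prob \<rho> \<and> (\<forall>\<mu>. borel_prob \<mu> \<longrightarrow> energy K \<rho> \<le> energy K \<mu>)"

definition zero_center_of_mass :: "(real^2) measure \<Rightarrow> bool" where
  "zero_center_of_mass \<rho> \<longleftrightarrow> integrable \<rho> (\<lambda>x. x) \<and> (\<integral>x. x \<partial>\<rho>) = 0"

definition supp :: "'a::topological_space measure \<Rightarrow> 'a set" where
  "supp \<rho> = {x. \<forall>U. open U \<and> x \<in> U \<longrightarrow> emeasure \<rho> U > 0}"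

end

theory Submission
  imports Defs
begin

text \<open>
  The bound comes from comparing the potential \<open>U x = \<integral> W (x - y) d\<rho> y\<close> of a minimizer \<open>\<rho>\<close> with a
  constant that does not depend on \<open>\<alpha>\<close>.

  The minimal energy is bounded uniformly in \<open>\<alpha>\<close>: the profile \<open>\<omega>\<close> vanishes in the vertical
  directions, so the uniform measure on a vertical segment does not feel the anisotropic term, and
  its energy is finite because \<open>s < 1\<close> (\<open>energy_vertical_segment_le\<close>). Moreover the potential of a
  minimizer is bounded by a multiple of its energy almost everywhere: otherwise one could
  remove the points of high potential, renormalize, and lower the energy
  (\<open>minimizer_potential_bound\<close>). Hence \<open>U < D\<close> holds \<open>\<rho>\<close>-almost everywhere with \<open>D\<close> depending
  on \<open>s\<close> only.

  Each part of the kernel now gives a bound, through the centre of mass: as \<open>x\<close> is the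
  \<open>\<rho>\<close>-average of \<open>x - y\<close>, its size is controlled by averages of \<open>x - y\<close>
  (\<open>norm_le_mean_difference\<close>).
  The confining term \<open>|x - y|\<^sup>2\<close> bounds \<open>|x|\<close> by some \<open>R\<close> (\<open>norm_le_of_potential\<close>). On the ball of
  radius \<open>R\<close>, with \<open>z = x - y\<close> and \<open>z\<^sub>1 = |z| cos \<theta>\<close>, the lower bound on \<open>\<omega>\<close> makes the anisotropic
  term \<open>\<alpha> |z| powr (-s) \<omega> \<theta>\<close> at least a constant times \<open>\<alpha> |z\<^sub>1| powr \<kappa>\<close>, so the \<open>\<kappa>\<close>-th moment of
  \<open>x\<^sub>1 - y\<^sub>1\<close> is \<open>O (1 / \<alpha>)\<close> and \<open>|x\<^sub>1|\<close> is \<open>O (\<alpha> powr (- 1 / \<kappa>))\<close> (\<open>horizontal_extent_le\<close>). For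
  \<open>\<alpha> \<ge> 1\<close> this is smaller than the required \<open>\<alpha> powr (- 1 / (\<kappa> + 1))\<close>; for \<open>\<alpha> < 1\<close> the bound
  by \<open>R\<close> suffices. A closed condition that holds almost everywhere holds on the support.
\<close>

section \<open>The potential of a minimizer\<close>

lemma measurable_difference_kernel:
  fixes K :: "real^2 \<Rightarrow> ennreal"
  assumes K: "K \<in> borel_measurable borel"
    and "borel_prob \<rho>" "borel_prob \<mu>"
  shows "(\<lambda>(x, y). K (x - y)) \<in> borel_measurable (\<rho> \<Otimes>\<^sub>M \<mu>)"
proof -
  have [measurable_cong]: "sets \<rho> = sets borel" "sets \<mu> = sets borel"
    using assms(2,3) by (auto simp: borel_prob_def)
  note K[measurable]
  show ?thesis by measurable
qed

text \<open>
  Compare \<open>\<rho>\<close> with its normalized restriction to a set \<open>B\<close> of measure \<open>r\<close>. Minimality says that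
  the double integral \<open>I\<close> over \<open>B \<times> B\<close> is at least \<open>r\<^sup>2 J\<close>, where \<open>J\<close> is the full double integral
  (twice the energy). Since \<open>J \<ge> \<integral>\<^bsub>A\<^esub> U d\<rho> + I\<close> for the complement \<open>A\<close> of \<open>B\<close>, this leaves
  \<open>\<integral>\<^bsub>A\<^esub> U d\<rho> \<le> (1 - r\<^sup>2) J \<le> 2 J (1 - r)\<close>, so \<open>U\<close> cannot exceed \<open>2 J\<close> by a fixed amount on a
  set \<open>A\<close> of positive measure. The Euler--Lagrange equation would improve \<open>2 J\<close> to \<open>J\<close>, at the cost
  of a limiting argument.
\<close>

lemma minimizer_potential_bound:
  fixes K :: "real^2 \<Rightarrow> ennreal" and e D :: real
  assumes K: "K \<in> borel_measurable borel"
    and min: "energy_minimizer K \<rho>"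
    and e: "energy K \<rho> \<le> ennreal e" "0 \<le> e" and D: "4 * e < D"
  shows "AE x in \<rho>. (\<integral>\<^sup>+ y. K (x - y) \<partial>\<rho>) < ennreal D"
proof -
  have bp: "borel_prob \<rho>" using min by (simp add: energy_minimizer_def)
  interpret prob_space \<rho> using bp by (simp add: borel_prob_def)
  have S[measurable_cong]: "sets \<rho> = sets borel" using bp by (simp add: borel_prob_def)
  have sp: "space \<rho> = UNIV" using S by (metis sets_eq_imp_space_eq space_borel)
  note measurable_difference_kernel[OF K bp bp, measurable]
  note K[measurable]
  define U where "U = (\<lambda>x. \<integral>\<^sup>+ y. K (x - y) \<partial>\<rho>)"
  have [measurable]: "U \<in> borel_measurable borel"
    unfolding U_def by measurable
  define A where "A = {x. ennreal D \<le> U x}"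
  have [measurable]: "A \<in> sets borel" unfolding A_def by measurable
  define B where "B = - A"
  have [measurable]: "B \<in> sets borel" unfolding B_def by measurable
  define r where "r = measure \<rho> B"
  have mA: "measure \<rho> A = 1 - r"
    using prob_compl[of A] by (simp add: r_def B_def sp Compl_eq_Diff_UNIV)
  have r01: "0 \<le> r" "r \<le> 1" by (simp_all add: r_def)
  define E where "E = enn2real (energy K \<rho>)"
  have E: "energy K \<rho> = ennreal E"
    using e(1) ennreal_enn2real_if[of "energy K \<rho>"] by (auto simp: E_def top_unique split: if_splits)
  have E0: "0 \<le> E" by (simp add: E_def)
  have Ee: "E \<le> e" using e E E0 by (simp add: ennreal_le_iff)
  have J: "(\<integral>\<^sup>+ x. U x \<partial>\<rho>) = ennreal (2 * E)"
  proof -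
    have "(\<integral>\<^sup>+ x. U x \<partial>\<rho>) = 2 * ((1 / 2) * (\<integral>\<^sup>+ x. U x \<partial>\<rho>))"
      by (simp add: mult.assoc[symmetric] ennreal_times_divide)
    also have "\<dots> = 2 * ennreal E" using E by (simp add: energy_def U_def)
    finally show ?thesis using E0 by (simp add: ennreal_mult)
  qed
  define I where "I = (\<integral>\<^sup>+ x. (\<integral>\<^sup>+ y. K (x - y) * indicator B y \<partial>\<rho>) * indicator B x \<partial>\<rho>)"
  have low: "ennreal (2 * E * r\<^sup>2) \<le> I"
  proof (cases "r = 0")
    case False
    have em: "emeasure \<rho> B = ennreal r" by (simp add: r_def emeasure_eq_measure)
    let ?\<nu> = "uniform_measure \<rho> B"
    have bpn: "borel_prob ?\<nu>"
      using False S em r01 by (auto simp: borel_prob_def ennreal_eq_0_iff intro!: prob_space_uniform_measure)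
    have in_K: "(\<integral>\<^sup>+ y. K (x - y) \<partial>?\<nu>) = (\<integral>\<^sup>+ y. K (x - y) * indicator B y \<partial>\<rho>) / ennreal r" for x
      by (subst nn_integral_uniform_measure) (auto simp: em)
    have "energy K ?\<nu> = (1/2) * ((\<integral>\<^sup>+ x. (\<integral>\<^sup>+ y. K (x - y) * indicator B y \<partial>\<rho>) / ennreal r * indicator B x \<partial>\<rho>) / ennreal r)"
      unfolding energy_def in_K
      by (subst nn_integral_uniform_measure) (auto simp: em)
    also have "\<dots> = (1/2) * (I / ennreal r / ennreal r)"
      unfolding I_def
      by (subst nn_integral_divide[symmetric]) (auto simp: divide_ennreal_def mult_ac)
    finally have "ennreal E \<le> (1/2) * (I / ennreal r / ennreal r)"
      using min bpn E by (metis energy_minimizer_def)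
    then have "(2 * ennreal r * ennreal r) * ennreal E \<le> (2 * ennreal r * ennreal r) * ((1/2) * (I / ennreal r / ennreal r))"
      by (rule mult_left_mono) simp
    also have "\<dots> = (2 * (1/2)) * (ennreal r * (1 / ennreal r)) * (ennreal r * (1 / ennreal r)) * I"
      by (simp add: divide_ennreal_def mult_ac)
    also have "\<dots> = I"
      using False r01 by (simp add: ennreal_times_divide)
    finally show ?thesis
      using r01 E0 by (simp add: ennreal_mult power2_eq_square mult_ac)
  qed simp
  have split: "(\<integral>\<^sup>+ x\<in>A. U x \<partial>\<rho>) + I \<le> ennreal (2 * E)"
  proof -
    have "I \<le> (\<integral>\<^sup>+ x\<in>B. U x \<partial>\<rho>)"
      unfolding I_def U_def
      by (intro nn_integral_mono mult_right_mono) (auto simp: indicator_def)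
    then have "(\<integral>\<^sup>+ x\<in>A. U x \<partial>\<rho>) + I \<le> (\<integral>\<^sup>+ x\<in>A. U x \<partial>\<rho>) + (\<integral>\<^sup>+ x\<in>B. U x \<partial>\<rho>)"
      by (rule add_left_mono)
    also have "\<dots> = (\<integral>\<^sup>+ x. U x * indicator A x + U x * indicator B x \<partial>\<rho>)"
      by (rule nn_integral_add[symmetric]) auto
    also have "\<dots> = (\<integral>\<^sup>+ x. U x \<partial>\<rho>)"
      by (rule nn_integral_cong) (auto simp: B_def indicator_def)
    finally show ?thesis using J by simp
  qed
  have D0: "0 < D" using D e by simp
  have "ennreal (D * (1 - r)) = (\<integral>\<^sup>+ x\<in>A. ennreal D \<partial>\<rho>)"
    using D0 r01 by (simp add: nn_integral_cmult_indicator emeasure_eq_measure mA ennreal_mult)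
  also have "\<dots> \<le> (\<integral>\<^sup>+ x\<in>A. U x \<partial>\<rho>)"
    by (intro nn_integral_mono) (auto simp: A_def indicator_def)
  finally have "ennreal (D * (1 - r)) + ennreal (2 * E * r\<^sup>2) \<le> ennreal (2 * E)"
    using add_mono[OF _ low] split by (meson order_trans)
  then have "D * (1 - r) + 2 * E * r\<^sup>2 \<le> 2 * E"
    using D0 E0 r01 by (simp add: ennreal_plus[symmetric] ennreal_le_iff del: ennreal_plus)
  then have "(D - 2 * E * (1 + r)) * (1 - r) \<le> 0"
    by (simp add: algebra_simps power2_eq_square)
  moreover have "0 < D - 2 * E * (1 + r)"
  proof -
    have "E * (1 + r) \<le> e * 2" using Ee E0 r01 by (intro mult_mono) auto
    then show ?thesis using D by linarith
  qed
  ultimately have "1 - r \<le> 0" by (simp add: mult_le_0_iff)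
  then have "measure \<rho> A = 0" using mA r01 by simp
  then have "A \<in> null_sets \<rho>" by (auto simp: null_sets_def emeasure_eq_measure S)
  then show ?thesis
    by (rule AE_I') (auto simp: A_def U_def not_less)
qed

section \<open>The anisotropic kernel\<close>

lemma borel_measurable_Arg: "Arg \<in> borel_measurable borel"
proof -
  have [measurable]: "(\<lambda>z::complex. if z \<in> - \<real>\<^sub>\<le>\<^sub>0 then Arg z else pi) \<in> borel_measurable borel"
    by (rule borel_measurable_continuous_on_if) (auto intro!: continuous_intros simp: closed_nonpos_Reals_complex)
  have "(\<lambda>z::complex. if z = 0 then 0 else if z \<in> - \<real>\<^sub>\<le>\<^sub>0 then Arg z else pi) \<in> borel_measurable borel"
    by measurable
  also have "(\<lambda>z::complex. if z = 0 then 0 else if z \<in> - \<real>\<^sub>\<le>\<^sub>0 then Arg z else pi) = Arg"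
  proof
    fix z :: complex
    show "(if z = 0 then 0 else if z \<in> - \<real>\<^sub>\<le>\<^sub>0 then Arg z else pi) = Arg z"
    proof (cases "z = 0")
      case False
      then show ?thesis
        using Arg_eq_pi[of z] by (auto simp: complex_nonpos_Reals_iff complex_eq_iff)
    qed (simp add: Arg_zero)
  qed
  finally show ?thesis .
qed

lemma borel_measurable_angle: "angle \<in> borel_measurable borel"
proof -
  have "(\<lambda>x::real^2. Complex (x $ 1) (x $ 2)) \<in> borel_measurable borel"
    unfolding Complex_eq by measurable
  then show ?thesis
    unfolding angle_def by (rule measurable_compose[OF _ borel_measurable_Arg])
qed

lemma borel_measurable_W:
  assumes "smooth \<omega>"
  shows "W s \<omega> \<alpha> \<in> borel_measurable borel"
proof -
  have "\<omega> differentiable (at x)" for x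
    using assms[unfolded smooth_def, THEN spec[of _ 0]] by simp
  then have [measurable]: "\<omega> \<in> borel_measurable borel"
    by (intro borel_measurable_continuous_onI)
       (simp add: continuous_at_imp_continuous_on differentiable_imp_continuous_within)
  note borel_measurable_angle[measurable]
  show ?thesis unfolding W_def by measurable
qed

text \<open>
  The lower bound on the profile enters only through \<open>|cos \<theta>| \<le> |\<theta> - \<pi> / 2|\<close>: unlike the distance to
  \<open>\<pi> / 2\<close>, the cosine is invariant under \<open>\<theta> \<mapsto> \<theta> + \<pi>\<close> up to sign, and it is the quotient of
  \<open>x\<^sub>1\<close> and \<open>|x|\<close>.
\<close>

lemma profile_ge_cos_power:
  fixes c \<kappa> :: real and \<omega> :: "real \<Rightarrow> real"
  assumes "c > 0" "\<kappa> \<ge> 0"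
    and per: "\<And>\<theta>. \<omega> (\<theta> + pi) = \<omega> \<theta>"
    and low: "\<And>\<theta>. \<theta> \<in> {0..pi} \<Longrightarrow> \<omega> \<theta> \<ge> c * \<bar>\<theta> - pi / 2\<bar> powr \<kappa>"
    and \<theta>: "- pi < \<theta>" "\<theta> \<le> pi"
  shows "\<omega> \<theta> \<ge> c * \<bar>cos \<theta>\<bar> powr \<kappa>"
proof -
  have *: "\<omega> t \<ge> c * \<bar>cos t\<bar> powr \<kappa>" if "t \<in> {0..pi}" for t
  proof -
    have "\<bar>cos t\<bar> = \<bar>sin (t - pi / 2)\<bar>" by (simp add: sin_diff)
    also have "\<dots> \<le> \<bar>t - pi / 2\<bar>" by (rule abs_sin_x_le_abs_x)
    finally have "\<bar>cos t\<bar> powr \<kappa> \<le> \<bar>t - pi / 2\<bar> powr \<kappa>"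
      using assms by (intro powr_mono2) auto
    then show ?thesis using low[OF that] assms(1)
      by (meson mult_left_mono less_imp_le order_trans)
  qed
  show ?thesis
  proof (cases "0 \<le> \<theta>")
    case True then show ?thesis using * \<theta> by simp
  next
    case False
    then show ?thesis using *[of "\<theta> + pi"] \<theta> per[of \<theta>] by simp
  qed
qed

lemma fst_eq_norm_cos_angle: "x $ 1 = norm x * cos (angle x)"
  by (subst polar_angle) simp

text \<open>
  With \<open>z\<^sub>1 = |z| cos \<theta>\<close>, the anisotropic term is at least
  \<open>\<alpha> c |z| powr (- s - \<kappa>) |z\<^sub>1| powr \<kappa>\<close>; the power of \<open>|z|\<close> is smallest at \<open>|z| = R\<close>.
\<close>

lemma W_ge_horizontal_power:
  fixes c \<kappa> s \<alpha> R :: real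
  assumes "s > 0" "c > 0" "\<kappa> \<ge> 0" "\<alpha> > 0"
    and per: "\<And>\<theta>. \<omega> (\<theta> + pi) = \<omega> \<theta>"
    and low: "\<And>\<theta>. \<theta> \<in> {0..pi} \<Longrightarrow> \<omega> \<theta> \<ge> c * \<bar>\<theta> - pi / 2\<bar> powr \<kappa>"
    and z: "norm z \<le> R"
  shows "ennreal (\<alpha> * \<bar>z $ 1\<bar> powr \<kappa>) \<le> ennreal (R powr (s + \<kappa>) / c) * W s \<omega> \<alpha> z"
proof (cases "z = 0")
  case True
  then show ?thesis by simp
next
  case False
  let ?n = "norm z"
  have n: "0 < ?n" "0 < R" using False z by (auto intro: less_le_trans[of 0 "norm z" R])
  have b: "- pi < angle z" "angle z \<le> pi" using Arg_bounded by (auto simp: angle_def)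
  have om: "c * \<bar>cos (angle z)\<bar> powr \<kappa> \<le> \<omega> (angle z)"
    using profile_ge_cos_power[OF \<open>c > 0\<close> \<open>\<kappa> \<ge> 0\<close> per low b] .
  have om0: "0 \<le> \<omega> (angle z)" by (rule order_trans[OF _ om]) (use \<open>c > 0\<close> in simp)
  have "\<alpha> * \<bar>z $ 1\<bar> powr \<kappa> = ?n powr (s + \<kappa>) / c * (?n powr (-s) * (\<alpha> * (c * \<bar>cos (angle z)\<bar> powr \<kappa>)))"
    using n \<open>c > 0\<close>
    by (subst fst_eq_norm_cos_angle) (simp add: abs_mult powr_mult powr_add powr_minus field_simps)
  also have "\<dots> \<le> R powr (s + \<kappa>) / c * (?n powr (-s) * (1 + \<alpha> * \<omega> (angle z)) + ?n\<^sup>2)"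
  proof (intro mult_mono divide_right_mono powr_mono2)
    have "?n powr (-s) * (\<alpha> * (c * \<bar>cos (angle z)\<bar> powr \<kappa>)) \<le> ?n powr (-s) * (1 + \<alpha> * \<omega> (angle z))"
      using om \<open>\<alpha> > 0\<close> by (intro mult_left_mono) (auto intro: add_increasing mult_left_mono)
    then show "?n powr (-s) * (\<alpha> * (c * \<bar>cos (angle z)\<bar> powr \<kappa>)) \<le> ?n powr (-s) * (1 + \<alpha> * \<omega> (angle z)) + ?n\<^sup>2"
      by (rule order_trans) simp
  qed (use assms n om0 in auto)
  finally show ?thesis
    using False n om0 \<open>\<alpha> > 0\<close> \<open>c > 0\<close>
    by (simp add: W_def ennreal_mult[symmetric] ennreal_leI del: ennreal_plus)
qed

lemma profile_zero_on_vertical_axis: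
  assumes per: "\<And>\<theta>. \<omega> (\<theta> + pi) = \<omega> \<theta>" and z: "\<omega> (pi / 2) = 0"
    and x: "x $ 1 = 0" "x \<noteq> 0"
  shows "\<omega> (angle x) = 0"
proof -
  have c: "cos (angle x) = 0" using x fst_eq_norm_cos_angle[of x] by simp
  have b: "- pi < angle x" "angle x \<le> pi" using Arg_bounded by (auto simp: angle_def)
  show ?thesis
  proof (cases "0 \<le> angle x")
    case True
    then have "angle x = pi / 2" using cos_inj_pi[of "angle x" "pi / 2"] b c by simp
    then show ?thesis using z by metis
  next
    case False
    then have "angle x + pi = pi / 2" using cos_inj_pi[of "angle x + pi" "pi / 2"] b c by simp
    then show ?thesis using z per[of "angle x"] by metis
  qed
qed

section \<open>A competitor whose energy does not depend on the anisotropy\<close>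

lemma nn_integral_powr_unit_interval:
  fixes s :: real
  assumes "s < 1"
  shows "(\<integral>\<^sup>+ v. ennreal ((v powr (-s) + 1) * indicator {0..1} v) \<partial>lborel) = ennreal (1 / (1 - s) + 1)"
proof (rule nn_integral_has_integral_lborel)
  have "((\<lambda>v. v powr (-s) + 1) has_integral (1 powr (-s + 1) / (-s + 1) + 1)) {0..1::real}"
    using assms has_integral_const_real[of "1::real" 0 1]
    by (intro has_integral_add has_integral_powr_from_0) auto
  then have "((\<lambda>v. if v \<in> {0..1} then v powr (-s) + 1 else 0) has_integral (1 / (1 - s) + 1)) UNIV"
    by (subst has_integral_restrict_UNIV) simp
  then show "((\<lambda>v. (v powr (-s) + 1) * indicator {0..1} v) has_integral (1 / (1 - s) + 1)) UNIV"
    by (rule has_integral_eq[rotated]) (auto simp: indicator_def)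
qed (auto simp: indicator_def)

definition vertical_segment :: "(real^2) measure" where
  "vertical_segment = distr (uniform_measure lborel {0..1}) borel (\<lambda>t. t *\<^sub>R axis 2 1)"

lemma borel_prob_vertical_segment: "borel_prob vertical_segment"
proof -
  have "prob_space (uniform_measure lborel {0..1::real})"
    by (rule prob_space_uniform_measure) auto
  then show ?thesis
    unfolding borel_prob_def vertical_segment_def
    by (auto intro!: prob_space.prob_space_distr)
qed

lemma nn_integral_vertical_segment:
  fixes f :: "real^2 \<Rightarrow> ennreal"
  assumes [measurable]: "f \<in> borel_measurable borel"
  shows "(\<integral>\<^sup>+ x. f x \<partial>vertical_segment) = (\<integral>\<^sup>+ t\<in>{0..1}. f (t *\<^sub>R axis 2 1) \<partial>lborel)"
  unfolding vertical_segment_def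
  by (subst nn_integral_distr) (auto simp: nn_integral_uniform_measure divide_ennreal_def)

lemma energy_vertical_segment_le:
  fixes s \<alpha> :: real
  assumes s: "s < 1" and sm: "smooth \<omega>"
    and per: "\<And>\<theta>. \<omega> (\<theta> + pi) = \<omega> \<theta>" and z: "\<omega> (pi / 2) = 0"
  shows "energy (W s \<omega> \<alpha>) vertical_segment \<le> ennreal (1 / (1 - s) + 1)"
proof -
  let ?e = "1 / (1 - s) + 1"
  note borel_measurable_W[OF sm, measurable]
  have bp: "borel_prob vertical_segment" by (rule borel_prob_vertical_segment)
  then interpret prob_space vertical_segment by (simp add: borel_prob_def)
  have [measurable_cong]: "sets vertical_segment = sets borel" using bp by (simp add: borel_prob_def)
  note measurable_difference_kernel[OF borel_measurable_W[OF sm] bp bp, measurable]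
  \<comment> \<open>On the vertical axis the kernel at \<open>v\<close> is dominated by \<open>h \<bar>v\<bar>\<close>. Writing this as
    \<open>h v + h (- v)\<close> allows both halves to be integrated by translation.\<close>
  define h where "h = (\<lambda>v::real. ennreal ((v powr (-s) + 1) * indicator {0..1} v))"
  have [measurable]: "h \<in> borel_measurable borel" unfolding h_def by measurable
  have ih: "(\<integral>\<^sup>+ v. h v \<partial>lborel) = ennreal ?e"
    unfolding h_def using s by (rule nn_integral_powr_unit_interval)
  have axis: "axis 2 (1::real) \<noteq> (0::real^2)" "axis 2 (1::real) $ (1::2) = 0"
    by (simp_all add: axis_eq_0_iff) (simp add: axis_def)
  have kernel_le: "W s \<omega> \<alpha> (v *\<^sub>R axis 2 1) \<le> h v + h (- v)" if "v \<noteq> 0" "\<bar>v\<bar> \<le> 1" for v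
  proof -
    let ?x = "v *\<^sub>R axis 2 1 :: real^2"
    have x: "?x \<noteq> 0" "?x $ 1 = 0" "norm ?x = \<bar>v\<bar>" using that axis by auto

    have "W s \<omega> \<alpha> ?x = ennreal (\<bar>v\<bar> powr (-s) + \<bar>v\<bar>\<^sup>2)"
      using profile_zero_on_vertical_axis[OF per z x(2,1)] x by (simp add: W_def)
    also have "\<dots> \<le> ennreal (\<bar>v\<bar> powr (-s) + 1)"
      using that(2) by (intro ennreal_leI) (simp add: abs_square_le_1)
    also have "\<dots> = h v + h (- v)"
      using that by (cases "0 < v") (auto simp: h_def)
    finally show ?thesis .
  qed
  have potential_le: "(\<integral>\<^sup>+ y. W s \<omega> \<alpha> (t *\<^sub>R axis 2 1 - y) \<partial>vertical_segment) \<le> ennreal (2 * ?e)"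
    if t: "t \<in> {0..1}" for t
  proof -
    have "(\<integral>\<^sup>+ y. W s \<omega> \<alpha> (t *\<^sub>R axis 2 1 - y) \<partial>vertical_segment)
        = (\<integral>\<^sup>+ u\<in>{0..1}. W s \<omega> \<alpha> (t *\<^sub>R axis 2 1 - u *\<^sub>R axis 2 1) \<partial>lborel)"
      by (rule nn_integral_vertical_segment) measurable
    also have "\<dots> \<le> (\<integral>\<^sup>+ u. h (t - u) + h (u - t) \<partial>lborel)"
    proof (rule nn_integral_mono_AE)
      show "AE u in lborel. W s \<omega> \<alpha> (t *\<^sub>R axis 2 1 - u *\<^sub>R axis 2 1) * indicator {0..1} u \<le> h (t - u) + h (u - t)"
        using AE_lborel_singleton[of t]
      proof eventually_elim
        case (elim u)
        then show ?case
          using kernel_le[of "t - u"] t by (auto simp: indicator_def scaleR_diff_left[symmetric])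
      qed
    qed
    also have "\<dots> = (\<integral>\<^sup>+ u. h (t - u) \<partial>lborel) + (\<integral>\<^sup>+ u. h (u - t) \<partial>lborel)"
      by (rule nn_integral_add) auto
    also have "(\<integral>\<^sup>+ u. h (t - u) \<partial>lborel) = ennreal ?e"
      using nn_integral_real_affine[of h "-1" t] ih by simp
    also have "(\<integral>\<^sup>+ u. h (u - t) \<partial>lborel) = ennreal ?e"
      using nn_integral_real_affine[of h "1" "-t"] ih by (simp add: add.commute)
    finally show ?thesis using s by (simp add: ennreal_plus[symmetric] del: ennreal_plus)
  qed
  have "(\<integral>\<^sup>+ x. (\<integral>\<^sup>+ y. W s \<omega> \<alpha> (x - y) \<partial>vertical_segment) \<partial>vertical_segment)
     = (\<integral>\<^sup>+ t\<in>{0..1}. (\<integral>\<^sup>+ y. W s \<omega> \<alpha> (t *\<^sub>R axis 2 1 - y) \<partial>vertical_segment) \<partial>lborel)"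
    by (rule nn_integral_vertical_segment) measurable
  also have "\<dots> \<le> (\<integral>\<^sup>+ t\<in>{0..1::real}. ennreal (2 * ?e) \<partial>lborel)"
    using potential_le by (intro nn_integral_mono) (simp add: indicator_def)
  also have "\<dots> = ennreal (2 * ?e)"
    by (simp add: nn_integral_cmult_indicator)
  finally have "energy (W s \<omega> \<alpha>) vertical_segment \<le> (1 / 2) * ennreal (2 * ?e)"
    unfolding energy_def by (rule mult_left_mono) simp
  also have "\<dots> = (2 * (1/2)) * ennreal ?e"
    by (subst ennreal_mult') (simp_all add: mult_ac del: ennreal_plus)
  also have "\<dots> = ennreal ?e" by (simp add: ennreal_times_divide)
  finally show ?thesis .
qed

section \<open>Size of the support in terms of the potential\<close>

text \<open>
  The zero centre of mass gives \<open>g x = \<integral> g (x - y) d\<rho> y\<close> for linear \<open>g\<close>. It is applied to the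
  identity and to the first coordinate.
\<close>

lemma norm_le_mean_difference:
  fixes g :: "real^2 \<Rightarrow> 'b::{banach, second_countable_topology}"
  assumes "borel_prob \<rho>" "zero_center_of_mass \<rho>" and g: "bounded_linear g"
  shows "ennreal (norm (g x)) \<le> (\<integral>\<^sup>+ y. ennreal (norm (g (x - y))) \<partial>\<rho>)"
proof -
  interpret prob_space \<rho> using assms(1) by (simp add: borel_prob_def)
  interpret g: bounded_linear g by (rule g)
  have int: "integrable \<rho> (\<lambda>y. y)" "(\<integral>y. y \<partial>\<rho>) = 0"
    using assms(2) by (auto simp: zero_center_of_mass_def)
  have ig: "integrable \<rho> (\<lambda>y. g y)" "(\<integral>y. g y \<partial>\<rho>) = 0"
    using integrable_bounded_linear[OF g int(1)] integral_bounded_linear[OF g int(1)] int(2)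
    by (simp_all add: g.zero)
  have id: "integrable \<rho> (\<lambda>y. g (x - y))"
    unfolding g.diff using ig by (intro Bochner_Integration.integrable_diff) auto
  have "(\<integral>y. g (x - y) \<partial>\<rho>) = g x"
    unfolding g.diff using ig by (subst Bochner_Integration.integral_diff) (auto simp: prob_space)
  then have "norm (g x) \<le> (\<integral>y. norm (g (x - y)) \<partial>\<rho>)"
    by (metis integral_norm_bound)
  then have "ennreal (norm (g x)) \<le> ennreal (\<integral>y. norm (g (x - y)) \<partial>\<rho>)"
    by (rule ennreal_leI)
  also have "\<dots> = (\<integral>\<^sup>+ y. ennreal (norm (g (x - y))) \<partial>\<rho>)"
    using id by (intro nn_integral_eq_integral[symmetric]) auto
  finally show ?thesis .
qed

lemma norm_le_of_potential:
  assumes sm: "smooth \<omega>" and nonneg: "\<And>\<theta>. \<omega> \<theta> \<ge> 0" and "\<alpha> > 0"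
    and rho: "borel_prob \<rho>" "zero_center_of_mass \<rho>"
    and pot: "(\<integral>\<^sup>+ y. W s \<omega> \<alpha> (x - y) \<partial>\<rho>) < ennreal D" and D: "D \<ge> 0"
  shows "norm x \<le> 1 + D"
proof -
  interpret prob_space \<rho> using rho by (simp add: borel_prob_def)
  have [measurable_cong]: "sets \<rho> = sets borel" using rho by (simp add: borel_prob_def)
  note borel_measurable_W[OF sm, measurable]
  have W_ge: "ennreal (norm z) \<le> 1 + W s \<omega> \<alpha> z" for z
  proof (cases "z = 0")
    case False
    have "norm z \<le> 1 + (norm z)\<^sup>2"
      using sum_squares_ge_zero[of "norm z - 1" 0] by (simp add: power2_eq_square algebra_simps)
         (smt (verit) norm_ge_zero)
    also have "\<dots> \<le> 1 + (norm z powr (-s) * (1 + \<alpha> * \<omega> (angle z)) + (norm z)\<^sup>2)"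
      using nonneg[of "angle z"] \<open>\<alpha> > 0\<close> by simp
    finally have "ennreal (norm z) \<le> ennreal (1 + (norm z powr (-s) * (1 + \<alpha> * \<omega> (angle z)) + (norm z)\<^sup>2))"
      by (rule ennreal_leI)
    then show ?thesis using False nonneg[of "angle z"] \<open>\<alpha> > 0\<close> by (simp add: W_def)
  qed (simp add: W_def)
  have "ennreal (norm x) \<le> (\<integral>\<^sup>+ y. ennreal (norm (x - y)) \<partial>\<rho>)"
    using norm_le_mean_difference[OF rho bounded_linear_ident] by simp
  also have "\<dots> \<le> (\<integral>\<^sup>+ y. 1 + W s \<omega> \<alpha> (x - y) \<partial>\<rho>)"
    by (intro nn_integral_mono W_ge)
  also have "\<dots> = 1 + (\<integral>\<^sup>+ y. W s \<omega> \<alpha> (x - y) \<partial>\<rho>)"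
    by (subst nn_integral_add) (auto simp: emeasure_space_1)
  also have "\<dots> \<le> 1 + ennreal D" using pot by (intro add_left_mono) simp
  also have "\<dots> = ennreal (1 + D)" using D by simp
  finally show ?thesis using D by (simp add: ennreal_le_iff del: ennreal_plus)
qed

text \<open>
  A pointwise substitute for Jensen's inequality: integrated with \<open>\<epsilon>\<close> of the order of the \<open>L\<^sup>\<kappa>\<close>
  norm, it bounds the mean of \<open>t\<close> by a multiple of that norm.
\<close>

lemma linear_le_power_interpolation:
  fixes t \<epsilon> \<kappa> :: real
  assumes "0 < \<epsilon>" "0 \<le> t" "1 \<le> \<kappa>"
  shows "t \<le> \<epsilon> + \<epsilon> powr (1 - \<kappa>) * t powr \<kappa>"
proof (cases "t \<le> \<epsilon>")
  case True
  then show ?thesis by (simp add: add_increasing2)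
next
  case False
  then have "t = t powr (1 - \<kappa>) * t powr \<kappa>"
    using assms by (simp add: powr_add[symmetric])
  also have "\<dots> \<le> \<epsilon> powr (1 - \<kappa>) * t powr \<kappa>"
    using assms False by (intro mult_right_mono powr_mono2') auto
  finally show ?thesis using assms by simp
qed

text \<open>
  The potential bound makes the \<open>\<kappa>\<close>-th moment of \<open>x\<^sub>1 - y\<^sub>1\<close> of order \<open>1 / \<alpha>\<close>, and the choice
  \<open>\<epsilon> = \<alpha> powr (- 1 / \<kappa>)\<close> balances the two terms of \<open>linear_le_power_interpolation\<close>.
\<close>

lemma horizontal_extent_le:
  fixes c \<kappa> s \<alpha> R D :: real
  assumes sm: "smooth \<omega>" and "s > 0" "c > 0" "\<kappa> \<ge> 1" "\<alpha> > 0"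
    and per: "\<And>\<theta>. \<omega> (\<theta> + pi) = \<omega> \<theta>"
    and low: "\<And>\<theta>. \<theta> \<in> {0..pi} \<Longrightarrow> \<omega> \<theta> \<ge> c * \<bar>\<theta> - pi / 2\<bar> powr \<kappa>"
    and rho: "borel_prob \<rho>" "zero_center_of_mass \<rho>"
    and pot: "(\<integral>\<^sup>+ y. W s \<omega> \<alpha> (x - y) \<partial>\<rho>) < ennreal D" and D: "D \<ge> 0"
    and bdd: "AE y in \<rho>. norm y \<le> R" "norm x \<le> R"
  shows "\<bar>x $ 1\<bar> \<le> (1 + (2 * R) powr (s + \<kappa>) / c * D) * \<alpha> powr (- 1 / \<kappa>)"
proof -
  interpret prob_space \<rho> using rho by (simp add: borel_prob_def)
  have [measurable_cong]: "sets \<rho> = sets borel" using rho by (simp add: borel_prob_def)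
  note borel_measurable_W[OF sm, measurable]
  define \<epsilon> where "\<epsilon> = \<alpha> powr (- 1 / \<kappa>)"
  define M where "M = (2 * R) powr (s + \<kappa>) / c"
  have e: "0 < \<epsilon>" using \<open>\<alpha> > 0\<close> by (simp add: \<epsilon>_def)
  have M: "0 \<le> M" using \<open>c > 0\<close> by (simp add: M_def)
  have e_pow: "\<epsilon> powr (1 - \<kappa>) = \<epsilon> * \<alpha>"
  proof -
    have "\<epsilon> powr (- \<kappa>) = \<alpha>" using assms by (simp add: \<epsilon>_def powr_powr)
    then show ?thesis using e by (simp add: powr_diff powr_minus divide_inverse)
  qed
  have pw: "ennreal (norm ((x - y) $ 1)) \<le> ennreal \<epsilon> + ennreal (\<epsilon> * M) * W s \<omega> \<alpha> (x - y)"
    if "norm y \<le> R" for y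
  proof -
    let ?t = "\<bar>(x - y) $ 1\<bar>"
    have n: "norm (x - y) \<le> 2 * R"
      using norm_triangle_ineq4[of x y] that bdd(2) by linarith
    have "?t \<le> \<epsilon> + \<epsilon> * (\<alpha> * ?t powr \<kappa>)"
      using linear_le_power_interpolation[OF e, of ?t \<kappa>] \<open>\<kappa> \<ge> 1\<close> e_pow by (simp add: mult_ac)
    then have "ennreal ?t \<le> ennreal \<epsilon> + ennreal \<epsilon> * ennreal (\<alpha> * ?t powr \<kappa>)"
      using e \<open>\<alpha> > 0\<close> by (simp add: ennreal_mult[symmetric] ennreal_plus[symmetric] ennreal_leI del: ennreal_plus)
    also have "\<dots> \<le> ennreal \<epsilon> + ennreal \<epsilon> * (ennreal M * W s \<omega> \<alpha> (x - y))"
      unfolding M_def using assms n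
      by (intro add_left_mono mult_left_mono W_ge_horizontal_power) auto
    also have "\<dots> = ennreal \<epsilon> + ennreal (\<epsilon> * M) * W s \<omega> \<alpha> (x - y)"
      using e M by (simp add: ennreal_mult mult.assoc)
    finally show ?thesis by simp
  qed
  have "ennreal (norm (x $ 1)) \<le> (\<integral>\<^sup>+ y. ennreal (norm ((x - y) $ 1)) \<partial>\<rho>)"
    using norm_le_mean_difference[OF rho bounded_linear_vec_nth] .
  also have "\<dots> \<le> (\<integral>\<^sup>+ y. ennreal \<epsilon> + ennreal (\<epsilon> * M) * W s \<omega> \<alpha> (x - y) \<partial>\<rho>)"
    using bdd(1) by (intro nn_integral_mono_AE) (elim eventually_mono, rule pw)
  also have "\<dots> = ennreal \<epsilon> + ennreal (\<epsilon> * M) * (\<integral>\<^sup>+ y. W s \<omega> \<alpha> (x - y) \<partial>\<rho>)"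
    by (subst nn_integral_add) (auto simp: emeasure_space_1 nn_integral_cmult)
  also have "\<dots> \<le> ennreal \<epsilon> + ennreal (\<epsilon> * M) * ennreal D"
    using pot by (intro add_left_mono mult_left_mono) auto
  also have "\<dots> = ennreal ((1 + M * D) * \<epsilon>)"
    using e M D by (simp add: ennreal_mult[symmetric] ennreal_plus[symmetric] algebra_simps del: ennreal_plus)
  finally show ?thesis
    unfolding M_def[symmetric] \<epsilon>_def[symmetric] using e M D by (subst (asm) ennreal_le_iff) auto
qed

section \<open>From almost everywhere to the support\<close>

lemma AE_closed_imp_supp_subset:
  assumes "AE x in \<rho>. x \<in> F" "closed F" "sets \<rho> = sets borel"
  shows "supp \<rho> \<subseteq> F"
proof
  fix x assume x: "x \<in> supp \<rho>"
  have sp: "space \<rho> = UNIV" using assms(3) by (metis sets_eq_imp_space_eq space_borel)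
  have "emeasure \<rho> (- F) = 0"
    using assms by (subst (asm) AE_iff_measurable[of "-F"]) (auto simp: sp)
  then show "x \<in> F"
    using x assms(2) unfolding supp_def by (auto simp: open_Compl dest!: spec[of _ "- F"])
qed

theorem theorem5p7:
  fixes s c \<kappa> :: real and \<omega> :: "real \<Rightarrow> real"
  assumes "0 < s" and "s < 1"
    and "smooth \<omega>"
    and "\<And>\<theta>. \<omega> \<theta> \<ge> 0"
    and "\<exists>\<theta>. \<omega> \<theta> \<noteq> 0"
    and "\<And>\<theta>. \<omega> (\<theta> + pi) = \<omega> \<theta>"
    and "\<omega> (pi / 2) = 0"
    and "c > 0" and "\<kappa> \<ge> 2"
    and "\<And>\<theta>. \<theta> \<in> {0..pi} \<Longrightarrow> \<omega> \<theta> \<ge> c * \<bar>\<theta> - pi / 2\<bar> powr \<kappa>"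
  shows "\<exists>C::real. \<forall>\<alpha>>0. \<forall>\<rho>.
           energy_minimizer (W s \<omega> \<alpha>) \<rho> \<and> zero_center_of_mass \<rho> \<longrightarrow>
           (SUP x\<in>supp \<rho>. ereal \<bar>x $ 1\<bar>) \<le> ereal (C * \<alpha> powr (- 1 / (\<kappa> + 1)))"
proof -
  define e where "e = 1 / (1 - s) + 1"
  define D where "D = 4 * e + 1"
  define R where "R = 1 + D"
  define M where "M = 1 + (2 * R) powr (s + \<kappa>) / c * D"
  have e: "0 \<le> e" using assms by (simp add: e_def)
  have D: "0 \<le> D" "4 * e < D" using e by (simp_all add: D_def)
  have R: "0 \<le> R" using D by (simp add: R_def)
  have M: "0 \<le> M" using D assms by (simp add: M_def)
  show ?thesis
  proof (intro exI[of _ "max R M"] allI impI, elim conjE)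
    fix \<alpha> :: real and \<rho>
    assume \<alpha>: "0 < \<alpha>" and min: "energy_minimizer (W s \<omega> \<alpha>) \<rho>" and zc: "zero_center_of_mass \<rho>"
    have bp: "borel_prob \<rho>" using min by (simp add: energy_minimizer_def)
    have "energy (W s \<omega> \<alpha>) \<rho> \<le> energy (W s \<omega> \<alpha>) vertical_segment"
      using min borel_prob_vertical_segment by (simp add: energy_minimizer_def)
    also have "\<dots> \<le> ennreal e"
      unfolding e_def using assms by (intro energy_vertical_segment_le) auto
    finally have pot: "AE x in \<rho>. (\<integral>\<^sup>+ y. W s \<omega> \<alpha> (x - y) \<partial>\<rho>) < ennreal D"
      using minimizer_potential_bound[OF borel_measurable_W min _ e D(2)] assms(3) by blast
    then have ball: "AE x in \<rho>. norm x \<le> R"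
      unfolding R_def
      by eventually_elim (use norm_le_of_potential[OF assms(3,4) \<alpha> bp zc] D in blast)
    define b where "b = max R M * \<alpha> powr (- 1 / (\<kappa> + 1))"
    have "AE x in \<rho>. \<bar>x $ 1\<bar> \<le> b"
      using pot ball
    proof eventually_elim
      case (elim x)
      show ?case
      proof (cases "1 \<le> \<alpha>")
        case True
        have "\<bar>x $ 1\<bar> \<le> M * \<alpha> powr (- 1 / \<kappa>)"
          unfolding M_def
          using horizontal_extent_le[OF assms(3,1,8) _ \<alpha> assms(6,10) bp zc elim(1) D(1) ball elim(2)] assms(9)
          by simp
        also have "\<dots> \<le> max R M * \<alpha> powr (- 1 / (\<kappa> + 1))"
          using True assms(9) M by (intro mult_mono powr_mono) (auto simp: field_simps)
        finally show ?thesis by (simp add: b_def)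
      next
        case False
        have "\<bar>x $ 1\<bar> \<le> R * 1" using component_le_norm_cart[of x 1] elim(2) by simp
        also have "\<dots> \<le> max R M * \<alpha> powr (- 1 / (\<kappa> + 1))"
        proof (intro mult_mono)
          have "\<alpha> powr 0 \<le> \<alpha> powr (- 1 / (\<kappa> + 1))"
            using False \<alpha> assms(9) by (intro powr_mono') (auto simp: field_simps)
          then show "1 \<le> \<alpha> powr (- 1 / (\<kappa> + 1))" using \<alpha> by simp
        qed (use R in auto)
        finally show ?thesis by (simp add: b_def)
      qed
    qed
    then have "supp \<rho> \<subseteq> {x. \<bar>x $ 1\<bar> \<le> b}"
      using bp by (intro AE_closed_imp_supp_subset)
        (auto simp: borel_prob_def intro!: closed_Collect_le continuous_intros)
    then show "(SUP x\<in>supp \<rho>. ereal \<bar>x $ 1\<bar>) \<le> ereal (max R M * \<alpha> powr (- 1 / (\<kappa> + 1)))"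
      by (intro SUP_least) (auto simp: b_def)
  qed
qed

end
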